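(* Let $m,n\in\mathbb{N}$, let $x\in C^{n+1}\left(\prod_{i=1}^m[a_i,b_i],\mathbb{R}\right)$, and let $\alpha_k:[a_k,b_k]\to(0,1)$ for $k\in\{1,\ldots,m\}$. Then, for all $k\in\{1,\ldots,m\}$, all $N\in\mathbb{N}$ with $N\geq n$, and all $\overline t=(t_1,\ldots,t_m)\in\prod_{i=1}^m[a_i,b_i]$ with $t_k<b_k$, writing $\alpha=\alpha_k(t_k)$, $$ {}^{C}_{t_k}\mathbb{D}_{b_k}^{\alpha_k(t_k)} x(\overline t)=\sum_{p=1}^{n}C_p\,(b_k-t_k)^{p-\alpha}\,\frac{\partial^p x}{\partial t_k^p}[t_k]_k+\sum_{p=n}^N D_p\,(b_k-t_k)^{n-p-\alpha}\,W_p(\overline t)+E(\overline t), $$ where the approximation error $E(\overline t)$ is bounded by $$ E(\overline t)\leq M_{n+1}(\overline t)\,\frac{\exp\left((n-\alpha)^2+n-\alpha\right)}{\Gamma(n+1-\alpha)\,N^{n-\alpha}\,(n-\alpha)}\,(b_k-t_k)^{n+1-\alpha}. $$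
   Context: $\Gamma$ is the Gamma function. For $\overline t=(t_1,\ldots,t_m)$ and $\tau\in[a_k,b_k]$, put $[\tau]_k=(t_1,\ldots,t_{k-1},\tau,t_{k+1},\ldots,t_m)\in\mathbb{R}^m$ (so $[t_k]_k=\overline t$); $\frac{\partial^p x}{\partial t_k^p}[\tau]_k$ is the $p$-th partial derivative of $x$ in the $k$-th variable evaluated at $[\tau]_k$. The type III partial right Caputo derivative of order $\alpha_k(t_k)$ is $$ {}^{C}_{t_k}\mathbb{D}_{b_k}^{\alpha_k(t_k)} x(\overline t)=\frac{-1}{\Gamma(1-\alpha_k(t_k))}\int_{t_k}^{b_k}(\tau-t_k)^{-\alpha_k(t_k)}\frac{\partial x}{\partial t_k}[\tau]_k\,d\tau . $$ For fixed $n,N,k,\overline t$ and with $\alpha=\alpha_k(t_k)$, define $$ C_p=\frac{(-1)^p}{\Gamma(p+1-\alpha)}\left[1+\sum_{l=n-p+1}^N\frac{\Gamma(\alpha-n+l)}{\Gamma(\alpha-p)\,(l-n+p)!}\right]\ (1\le p\le n),\qquad D_p=\frac{-\Gamma(\alpha-n+p)}{\Gamma(1-\alpha)\Gamma(\alpha)\,(p-n)!}\ (p\ge n), $$ $$ W_p(\overline t)=\int_{t_k}^{b_k}(b_k-\tau)^{p-n}\frac{\partial x}{\partial t_k}[\tau]_k\,d\tau\ (p\ge n),\qquad M_p(\overline t)=\max_{\tau\in[t_k,b_k]}\left|\frac{\partial^p x}{\partial t_k^p}[\tau]_k\right|, $$ with the convention $(b_k-\tau)^0=1$. *)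

theory Defs
  imports "HOL-Analysis.Analysis"
begin

definition subst_coord :: "real ^ 'm::finite \<Rightarrow> 'm \<Rightarrow> real \<Rightarrow> real ^ 'm" where
  "subst_coord t k \<tau> = (\<chi> i. if i = k then \<tau> else t $ i)"

text \<open>
  Partial derivatives on the closed box with corners \<open>a\<close> and \<open>b\<close>. The derivative in the
  \<open>k\<close>-th variable is taken within \<open>[a\<^sub>k, b\<^sub>k]\<close>, so it is one-sided on the two faces
  orthogonal to that direction and depends only on the values of the function on the box.
\<close>

definition partial_differentiable ::
  "real ^ 'm::finite \<Rightarrow> real ^ 'm \<Rightarrow> 'm \<Rightarrow> (real ^ 'm \<Rightarrow> real) \<Rightarrow> real ^ 'm \<Rightarrow> bool" where
  "partial_differentiable a b k f t \<longleftrightarrow>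
     (\<lambda>\<tau>. f (subst_coord t k \<tau>)) differentiable (at (t $ k) within {a $ k..b $ k})"

definition partial_deriv ::
  "real ^ 'm::finite \<Rightarrow> real ^ 'm \<Rightarrow> 'm \<Rightarrow> (real ^ 'm \<Rightarrow> real) \<Rightarrow> real ^ 'm \<Rightarrow> real" where
  "partial_deriv a b k f t =
     vector_derivative (\<lambda>\<tau>. f (subst_coord t k \<tau>)) (at (t $ k) within {a $ k..b $ k})"

abbreviation higher_partial_deriv ::
  "nat \<Rightarrow> real ^ 'm::finite \<Rightarrow> real ^ 'm \<Rightarrow> 'm \<Rightarrow> (real ^ 'm \<Rightarrow> real) \<Rightarrow> real ^ 'm \<Rightarrow> real" where
  "higher_partial_deriv p a b k \<equiv> partial_deriv a b k ^^ p"

text \<open>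
  \<open>C\<^sup>r\<close> on the closed box: all partial derivatives of order at most \<open>r\<close>, mixed ones
  included, exist and are continuous on the whole box.
\<close>

primrec Cr_on_box ::
  "nat \<Rightarrow> real ^ 'm::finite \<Rightarrow> real ^ 'm \<Rightarrow> (real ^ 'm \<Rightarrow> real) \<Rightarrow> bool" where
  "Cr_on_box 0 a b f \<longleftrightarrow> continuous_on (cbox a b) f"
| "Cr_on_box (Suc r) a b f \<longleftrightarrow>
     continuous_on (cbox a b) f \<and>
     (\<forall>k. (\<forall>t\<in>cbox a b. partial_differentiable a b k f t) \<and>
          Cr_on_box r a b (partial_deriv a b k f))"

definition caputo_right_III ::
  "real ^ 'm::finite \<Rightarrow> real ^ 'm \<Rightarrow> 'm \<Rightarrow> (real \<Rightarrow> real) \<Rightarrow> (real ^ 'm \<Rightarrow> real) \<Rightarrow> real ^ 'm \<Rightarrow> real"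
  where
  "caputo_right_III a b k \<alpha>\<^sub>k x t =
     - 1 / Gamma (1 - \<alpha>\<^sub>k (t $ k)) *
     integral {t $ k..b $ k}
       (\<lambda>\<tau>. (\<tau> - t $ k) powr (- \<alpha>\<^sub>k (t $ k)) * partial_deriv a b k x (subst_coord t k \<tau>))"

text \<open>
  The factorial arguments \<open>l - n + p\<close> and \<open>p - n\<close> are nonnegative in the ranges where
  \<open>coeff_C\<close> (for \<open>1 \<le> p \<le> n\<close>) and \<open>coeff_D\<close> (for \<open>n \<le> p\<close>) are used; the first one
  is written \<open>l + p - n\<close> so that the subtraction on naturals does not truncate.
\<close>

definition coeff_C :: "nat \<Rightarrow> nat \<Rightarrow> real \<Rightarrow> nat \<Rightarrow> real" where
  "coeff_C n N \<alpha> p =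
     (- 1) ^ p / Gamma (real p + 1 - \<alpha>) *
     (1 + (\<Sum>l = n - p + 1..N.
            Gamma (\<alpha> - real n + real l) / (Gamma (\<alpha> - real p) * fact (l + p - n))))"

definition coeff_D :: "nat \<Rightarrow> real \<Rightarrow> nat \<Rightarrow> real" where
  "coeff_D n \<alpha> p =
     - Gamma (\<alpha> - real n + real p) / (Gamma (1 - \<alpha>) * Gamma \<alpha> * fact (p - n))"

definition moment_W ::
  "real ^ 'm::finite \<Rightarrow> real ^ 'm \<Rightarrow> 'm \<Rightarrow> nat \<Rightarrow> (real ^ 'm \<Rightarrow> real) \<Rightarrow> nat \<Rightarrow> real ^ 'm \<Rightarrow> real"
  where
  "moment_W a b k n x p t =
     integral {t $ k..b $ k}
       (\<lambda>\<tau>. (b $ k - \<tau>) ^ (p - n) * partial_deriv a b k x (subst_coord t k \<tau>))"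

definition max_M ::
  "real ^ 'm::finite \<Rightarrow> real ^ 'm \<Rightarrow> 'm \<Rightarrow> (real ^ 'm \<Rightarrow> real) \<Rightarrow> nat \<Rightarrow> real ^ 'm \<Rightarrow> real" where
  "max_M a b k x p t =
     (GREATEST v. v \<in> (\<lambda>\<tau>. \<bar>higher_partial_deriv p a b k x (subst_coord t k \<tau>)\<bar>) ` {t $ k..b $ k})"

end

theory Submission
  imports Defs
begin

text \<open>
  Only the restriction of \<open>x\<close> to one coordinate line matters. Write \<open>t\<close>, \<open>b\<close> for
  \<open>t\<^sub>k\<close>, \<open>b\<^sub>k\<close>, let \<open>g\<^sub>p(\<tau>)\<close> be the \<open>p\<close>-th partial derivative at \<open>[\<tau>]\<^sub>k\<close>, and put
  \<open>L = b - t\<close>, \<open>\<gamma> = n - \<alpha>\<close>.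

  The binomial series in \<open>(b - \<tau>) / L\<close> expands \<open>(\<tau> - t)\<^sup>\<beta>\<close> around the right end point \<open>b\<close>.
  Let \<open>T\<^bsub>\<beta>,m\<^esub>\<close> be its partial sum of degree \<open>m\<close>, and
  \<open>K\<^bsub>\<beta>,m\<^esub>(\<tau>) = ((\<tau> - t)\<^sup>\<beta> - T\<^bsub>\<beta>,m\<^esub>(\<tau>)) / \<Gamma>(\<beta> + 1)\<close>. Three properties make this kernel
  work: its derivative is the kernel with \<open>\<beta>\<close> and \<open>m\<close> both lowered by one; it vanishes at \<open>b\<close>;
  and for \<open>\<beta> > 0\<close> its value at \<open>t\<close> is \<open>-T\<^bsub>\<beta>,m\<^esub>(t) / \<Gamma>(\<beta> + 1)\<close>, because the power itself is
  zero there. Integrating \<open>\<integral> K\<^bsub>\<gamma>,N\<^esub> g\<^bsub>n+1\<^esub>\<close> by parts \<open>n\<close> times therefore gives boundary terms at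
  \<open>t\<close> only, and leads down to \<open>\<integral> K\<^bsub>-\<alpha>,N-n\<^esub> g\<^sub>1\<close> (\<open>taylor_kernel_iterated_parts\<close>). The power in
  this last kernel is the Caputo integrand. The boundary terms are the summands with \<open>C\<^sub>p\<close>, since
  \<open>\<Gamma>(\<alpha> - p + i) / \<Gamma>(\<alpha> - p)\<close> is a rising factorial, and the polynomial \<open>T\<^bsub>-\<alpha>,N-n\<^esub>\<close> produces
  the summands with \<open>D\<^sub>p W\<^sub>p\<close>. So the error is exactly
  \<open>E = (-1)\<^bsup>n+1\<^esup> \<integral> K\<^bsub>\<gamma>,N\<^esub> g\<^bsub>n+1\<^esub>\<close>.

  It remains to bound the kernel uniformly. Let \<open>c\<^sub>i\<close> be the coefficients of \<open>(1 - u)\<^sup>\<gamma>\<close>. Their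
  partial sums are \<open>s\<^sub>K = \<Prod>\<^bsub>j=1..K\<^esub> (1 - \<gamma> / j)\<close>, and past the index \<open>\<gamma>\<close> they satisfy
  \<open>\<bar>c\<^bsub>K+1\<^esub>\<bar> = \<bar>s\<^sub>K\<bar> - \<bar>s\<^bsub>K+1\<^esub>\<bar>\<close>. By telescoping, the absolute tail of the series beyond \<open>N\<close> is at
  most \<open>\<bar>s\<^sub>N\<bar>\<close>, so that \<open>\<bar>K\<^bsub>\<gamma>,N\<^esub>\<bar> \<le> L\<^sup>\<gamma> \<bar>s\<^sub>N\<bar> / \<Gamma>(\<gamma> + 1)\<close> (\<open>abs_taylor_kernel_le\<close>). The factors
  of \<open>s\<^sub>N\<close> with \<open>j < n\<close> contribute at most 1 in absolute value and those with \<open>j \<ge> n\<close> at most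
  \<open>(n / (N + 1))\<^sup>\<gamma>\<close>. As \<open>n\<^sup>\<gamma> \<le> exp(\<gamma>(n - 1)) \<le> exp(\<gamma>\<^sup>2)\<close> and \<open>\<gamma> \<le> exp \<gamma>\<close>, the stated bound
  follows (\<open>abs_binomial_coeff_decay\<close>), and it holds for \<open>\<bar>E\<bar>\<close>.
\<close>

section \<open>Coefficients of the binomial series\<close>

text \<open>
  The coefficients of \<open>(1 - u)\<^sup>\<beta>\<close> are \<open>pochhammer (- \<beta>) i / fact i\<close>. Dividing that series by
  \<open>1 - u\<close> sums its coefficients, so their partial sums are the coefficients of
  \<open>(1 - u)\<^bsup>\<beta>-1\<^esup>\<close>. Everything about the tail is expressed through these partial sums, hence both
  sequences are here compared with the partial sum of index \<open>K\<close>.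
\<close>

lemma binomial_coeff_Suc:
  fixes \<beta> :: real
  shows "pochhammer (- \<beta>) (Suc K) / fact (Suc K)
           = - (\<beta> / (real K + 1)) * (pochhammer (1 - \<beta>) K / fact K)"
    and "pochhammer (1 - \<beta>) (Suc K) / fact (Suc K)
           = (1 - \<beta> / (real K + 1)) * (pochhammer (1 - \<beta>) K / fact K)"
proof -
  have pos: "real K + 1 \<noteq> 0" "(fact K :: real) \<noteq> 0" by auto
  have "pochhammer (- \<beta>) (Suc K) = - \<beta> * pochhammer (1 - \<beta>) K"
    by (simp add: pochhammer_rec algebra_simps)
  then show "pochhammer (- \<beta>) (Suc K) / fact (Suc K)
           = - (\<beta> / (real K + 1)) * (pochhammer (1 - \<beta>) K / fact K)"
    by simp
  have "pochhammer (1 - \<beta>) (Suc K) / fact (Suc K)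
          = ((1 - \<beta> + real K) / (real K + 1)) * (pochhammer (1 - \<beta>) K / fact K)"
    by (simp add: pochhammer_Suc ac_simps)
  also have "(1 - \<beta> + real K) / (real K + 1) = 1 - \<beta> / (real K + 1)"
    using pos by (simp add: field_simps)
  finally show "pochhammer (1 - \<beta>) (Suc K) / fact (Suc K)
           = (1 - \<beta> / (real K + 1)) * (pochhammer (1 - \<beta>) K / fact K)" .
qed

lemma sum_binomial_coeffs:
  fixes \<beta> :: real
  shows "(\<Sum>i\<le>K. pochhammer (- \<beta>) i / fact i) = pochhammer (1 - \<beta>) K / fact K"
proof (induction K)
  case (Suc K)
  define s where "s = pochhammer (1 - \<beta>) K / fact K"
  have "s + - (\<beta> / (real K + 1)) * s = (1 - \<beta> / (real K + 1)) * s"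
    by (simp add: left_diff_distrib)
  with Suc show ?case
    unfolding sum.atMost_Suc binomial_coeff_Suc s_def by simp
qed simp

text \<open>
  From the index \<open>\<beta>\<close> on, passing to the next partial sum multiplies it by a factor in
  \<open>[0, 1]\<close>. The partial sums then keep their sign and shrink, so each coefficient is in absolute
  value the amount by which they shrink.
\<close>

lemma abs_binomial_coeff_telescope:
  fixes \<beta> :: real
  assumes "0 \<le> \<beta>" "\<beta> \<le> real (Suc K)"
  shows "\<bar>pochhammer (- \<beta>) (Suc K) / fact (Suc K)\<bar>
           = \<bar>pochhammer (1 - \<beta>) K / fact K\<bar> - \<bar>pochhammer (1 - \<beta>) (Suc K) / fact (Suc K)\<bar>"
proof -
  have "0 \<le> \<beta> / (real K + 1)" "0 \<le> 1 - \<beta> / (real K + 1)"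
    using assms by (simp_all add: field_simps)
  then show ?thesis
    unfolding binomial_coeff_Suc abs_mult abs_minus_cancel
    by (simp only: abs_of_nonneg) (simp only: left_diff_distrib)
qed

lemma abs_binomial_coeff_tail:
  fixes \<beta> :: real
  assumes "0 \<le> \<beta>" "\<beta> \<le> real (Suc N)"
  shows "(\<Sum>i<j. \<bar>pochhammer (- \<beta>) (i + Suc N) / fact (i + Suc N)\<bar>)
           \<le> \<bar>pochhammer (1 - \<beta>) N / fact N\<bar>"
proof -
  have "(\<Sum>i<j. \<bar>pochhammer (- \<beta>) (i + Suc N) / fact (i + Suc N)\<bar>)
        = \<bar>pochhammer (1 - \<beta>) N / fact N\<bar> - \<bar>pochhammer (1 - \<beta>) (j + N) / fact (j + N)\<bar>"
  proof (induction j)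
    case 0
    show ?case by simp
  next
    case (Suc j)
    have "\<beta> \<le> real (Suc (j + N))"
      using assms by simp
    from abs_binomial_coeff_telescope[OF assms(1) this] Suc show ?case
      by (simp del: fact_Suc)
  qed
  then show ?thesis by simp
qed

text \<open>
  Each factor \<open>\<beta> - 1 - i\<close> is nonnegative in this range and at most \<open>n - 1 - i\<close>.
\<close>

lemma abs_pochhammer_le_fact:
  fixes \<beta> :: real
  assumes "real n - 1 \<le> \<beta>" "\<beta> \<le> real n" "n \<ge> 1"
  shows "\<bar>pochhammer (1 - \<beta>) (n - 1)\<bar> \<le> fact (n - 1)"
proof -
  have "\<bar>pochhammer (1 - \<beta>) (n - 1)\<bar> = (\<Prod>i=0..<n-1. \<bar>1 - \<beta> + real i\<bar>)"
    by (simp add: pochhammer_prod abs_prod)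
  also have "\<dots> \<le> (\<Prod>i=0..<n-1. real (n - 1 - i))"
    using assms by (intro prod_mono) (auto simp: of_nat_diff)
  also have "\<dots> = fact (n - 1)"
    by (simp add: fact_prod_rev)
  finally show ?thesis .
qed

text \<open>
  In every factor \<open>1 - \<beta> / M \<le> exp(-\<beta> / M)\<close>, whereas \<open>((M + 1) / M)\<^sup>\<beta> \<le> exp(\<beta> / M)\<close>.
  Hence the product is nonincreasing in \<open>j\<close> once the power is taken at the shifted argument
  \<open>n + j\<close>, one more than the index of the coefficient. With the unshifted power monotonicity
  would fail for \<open>\<beta> < 1\<close>. At \<open>j = 0\<close> it is at most \<open>n\<^sup>\<beta>\<close>, which is at most
  \<open>exp(\<beta>\<^sup>2)\<close> because \<open>ln n \<le> n - 1 \<le> \<beta>\<close>.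
\<close>

lemma abs_binomial_coeff_decay:
  fixes \<beta> :: real
  assumes "real n - 1 \<le> \<beta>" "\<beta> \<le> real n" "n \<ge> 1"
  shows "\<bar>pochhammer (1 - \<beta>) (n - 1 + j) / fact (n - 1 + j)\<bar> * real (n + j) powr \<beta>
           \<le> exp (\<beta>\<^sup>2)"
proof (induction j)
  case 0
  have "\<bar>pochhammer (1 - \<beta>) (n - 1) / fact (n - 1)\<bar> \<le> 1"
    using abs_pochhammer_le_fact[OF assms] by (simp add: field_simps)
  then have "\<bar>pochhammer (1 - \<beta>) (n - 1) / fact (n - 1)\<bar> * real n powr \<beta> \<le> 1 * real n powr \<beta>"
    by (intro mult_right_mono) auto
  also have "\<dots> = exp (\<beta> * ln (real n))"
    using assms by (simp add: powr_def)
  also have "\<dots> \<le> exp (\<beta> * \<beta>)"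
  proof -
    have "ln (real n) \<le> real n - 1"
      using assms by (intro ln_le_minus_one) auto
    then have "\<beta> * ln (real n) \<le> \<beta> * \<beta>"
      using assms by (intro mult_left_mono) auto
    then show ?thesis by simp
  qed
  finally show ?case by (simp add: power2_eq_square)
next
  case (Suc j)
  define M where "M = real (n + j)"
  define s where "s = pochhammer (1 - \<beta>) (n - 1 + j) / fact (n - 1 + j)"
  have M: "M > 0" "\<beta> \<le> M" and \<beta>: "0 \<le> \<beta>"
    using assms by (auto simp: M_def)
  have nj: "real (n - 1 + j) = M - 1"
    using assms by (simp add: M_def of_nat_diff)
  have step: "pochhammer (1 - \<beta>) (n - 1 + Suc j) / fact (n - 1 + Suc j) = (1 - \<beta> / M) * s"
    using binomial_coeff_Suc(2)[of \<beta> "n - 1 + j"] by (simp only: nj s_def add_Suc_right) simp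
  have "(1 - \<beta> / M) * (M + 1) powr \<beta> \<le> M powr \<beta>"
  proof -
    have "1 - \<beta> / M \<le> exp (- (\<beta> / M))"
      using exp_ge_add_one_self[of "- (\<beta> / M)"] by simp
    moreover have "(M + 1) powr \<beta> \<le> exp (\<beta> / M) * M powr \<beta>"
    proof -
      have "ln (M + 1) - ln M = ln ((M + 1) / M)"
        using M by (simp add: ln_div)
      also have "(M + 1) / M = 1 + 1 / M"
        using M by (simp add: field_simps)
      also have "ln (1 + 1 / M) \<le> 1 / M"
        using M by (intro ln_add_one_self_le_self) auto
      finally have "\<beta> * ln (M + 1) \<le> \<beta> * (1 / M + ln M)"
        using \<beta> by (intro mult_left_mono) auto
      then show ?thesis
        using M by (simp add: powr_def exp_add[symmetric] algebra_simps)
    qed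
    moreover have "0 \<le> 1 - \<beta> / M"
      using M by simp
    ultimately have "(1 - \<beta> / M) * (M + 1) powr \<beta> \<le> exp (- (\<beta> / M)) * (exp (\<beta> / M) * M powr \<beta>)"
      by (intro mult_mono) auto
    then show ?thesis by (simp add: exp_minus field_simps)
  qed
  then have "\<bar>s\<bar> * ((1 - \<beta> / M) * (M + 1) powr \<beta>) \<le> \<bar>s\<bar> * M powr \<beta>"
    by (intro mult_left_mono) auto
  also have "\<dots> \<le> exp (\<beta>\<^sup>2)"
    using Suc by (simp add: s_def M_def)
  finally show ?case
    unfolding step abs_mult using M by (simp add: M_def mult_ac add_ac)
qed

section \<open>The truncated power kernel\<close>

text \<open>
  The partial sum of degree \<open>m\<close> of the binomial series of \<open>(L - h)\<^sup>\<beta>\<close> in powers of \<open>h\<close>. Writing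
  its coefficients with \<^const>\<open>pochhammer\<close> absorbs the alternating signs and matches the quotients
  of Gamma values in the expansion.
\<close>

definition powr_taylor :: "real \<Rightarrow> real \<Rightarrow> nat \<Rightarrow> real \<Rightarrow> real" where
  "powr_taylor \<beta> L m h = (\<Sum>i\<le>m. pochhammer (- \<beta>) i / fact i * L powr (\<beta> - real i) * h ^ i)"

text \<open>
  The factor \<open>1 / \<Gamma>(\<beta> + 1)\<close> makes differentiation act as the index shift
  \<open>(\<beta> + 1, m + 1) \<mapsto> (\<beta>, m)\<close> without a scalar.
\<close>

definition taylor_kernel :: "real \<Rightarrow> real \<Rightarrow> real \<Rightarrow> nat \<Rightarrow> real \<Rightarrow> real" where
  "taylor_kernel t b \<beta> m \<tau> =
     ((\<tau> - t) powr \<beta> - powr_taylor \<beta> (b - t) m (b - \<tau>)) / Gamma (\<beta> + 1)"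

lemma powr_taylor_0: "L > 0 \<Longrightarrow> powr_taylor \<beta> L m 0 = L powr \<beta>"
  by (simp add: powr_taylor_def power_0_left sum.atMost_shift)

lemma powr_taylor_full:
  assumes "L > 0"
  shows "powr_taylor \<beta> L m L = L powr \<beta> * (\<Sum>i\<le>m. pochhammer (- \<beta>) i / fact i)"
proof -
  have "L powr (\<beta> - real i) * L ^ i = L powr \<beta>" for i
    using assms by (simp add: powr_diff powr_realpow)
  then show ?thesis
    by (simp add: powr_taylor_def sum_distrib_left mult.assoc mult.commute[of "L powr \<beta>"])
qed

lemma has_real_derivative_powr_taylor:
  "(powr_taylor (\<beta> + 1) L (Suc m) has_real_derivative - (\<beta> + 1) * powr_taylor \<beta> L m h) (at h)"
proof -
  have "pochhammer (- (\<beta> + 1)) (Suc i) / fact (Suc i) * L powr (\<beta> + 1 - real (Suc i))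
          * (real (Suc i) * h ^ i)
        = - (\<beta> + 1) * (pochhammer (- \<beta>) i / fact i * L powr (\<beta> - real i) * h ^ i)" for i
  proof -
    have "pochhammer (- (\<beta> + 1)) (Suc i) = - (\<beta> + 1) * pochhammer (- \<beta>) i"
      by (simp add: pochhammer_rec)
    then show ?thesis by simp
  qed
  moreover have "(powr_taylor (\<beta> + 1) L (Suc m) has_real_derivative
      (\<Sum>i\<le>m. pochhammer (- (\<beta> + 1)) (Suc i) / fact (Suc i) * L powr (\<beta> + 1 - real (Suc i))
          * (real (Suc i) * h ^ i))) (at h)"
  proof -
    have "((\<lambda>h. h ^ Suc i) has_real_derivative real (Suc i) * h ^ i) (at h)" for i
      using DERIV_pow[of "Suc i" h] by simp
    then have "((\<lambda>h. pochhammer (- (\<beta> + 1)) 0 / fact 0 * L powr (\<beta> + 1 - real 0) * h ^ 0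
        + (\<Sum>i\<le>m. pochhammer (- (\<beta> + 1)) (Suc i) / fact (Suc i) * L powr (\<beta> + 1 - real (Suc i)) * h ^ Suc i))
      has_real_derivative 0 + (\<Sum>i\<le>m. pochhammer (- (\<beta> + 1)) (Suc i) / fact (Suc i)
          * L powr (\<beta> + 1 - real (Suc i)) * (real (Suc i) * h ^ i))) (at h)"
      by (intro DERIV_add DERIV_sum DERIV_cmult) simp_all
    then show ?thesis
      unfolding powr_taylor_def sum.atMost_Suc_shift by simp
  qed
  ultimately show ?thesis
    by (simp only: powr_taylor_def sum_distrib_left)
qed

lemma continuous_on_powr_taylor [continuous_intros]:
  "continuous_on S f \<Longrightarrow> continuous_on S (\<lambda>\<tau>. powr_taylor \<beta> L m (f \<tau>))"
  unfolding powr_taylor_def by (intro continuous_intros)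

lemma taylor_kernel_at_right_end: "t < b \<Longrightarrow> taylor_kernel t b \<beta> m b = 0"
  by (simp add: taylor_kernel_def powr_taylor_0)

lemma continuous_on_taylor_kernel:
  assumes "\<beta> > 0"
  shows "continuous_on {t..b} (taylor_kernel t b \<beta> m)"
  unfolding taylor_kernel_def using assms
  by (intro continuous_intros continuous_on_powr') (auto simp: Gamma_eq_zero_iff elim!: nonpos_Ints_cases)

lemma has_real_derivative_taylor_kernel:
  assumes "\<beta> > - 1" "\<tau> > t"
  shows "(taylor_kernel t b (\<beta> + 1) (Suc m) has_real_derivative taylor_kernel t b \<beta> m \<tau>) (at \<tau>)"
proof -
  have G: "Gamma (\<beta> + 1 + 1) = (\<beta> + 1) * Gamma (\<beta> + 1)"
    using assms by (intro Gamma_plus1) (auto elim!: nonpos_Ints_cases)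
  have "(powr_taylor (\<beta> + 1) (b - t) (Suc m) \<circ> (\<lambda>\<tau>. b - \<tau>) has_real_derivative
          - (\<beta> + 1) * powr_taylor \<beta> (b - t) m (b - \<tau>) * (- 1)) (at \<tau>)"
    by (intro DERIV_chain has_real_derivative_powr_taylor) (auto intro!: derivative_eq_intros)
  then have "((\<lambda>\<tau>. powr_taylor (\<beta> + 1) (b - t) (Suc m) (b - \<tau>)) has_real_derivative
          (\<beta> + 1) * powr_taylor \<beta> (b - t) m (b - \<tau>)) (at \<tau>)"
    by (simp add: o_def algebra_simps)
  moreover have "((\<lambda>\<tau>. (\<tau> - t) powr (\<beta> + 1)) has_real_derivative (\<beta> + 1) * (\<tau> - t) powr \<beta>) (at \<tau>)"
    using assms by (auto intro!: derivative_eq_intros)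
  ultimately have "(taylor_kernel t b (\<beta> + 1) (Suc m) has_real_derivative
      ((\<beta> + 1) * (\<tau> - t) powr \<beta> - (\<beta> + 1) * powr_taylor \<beta> (b - t) m (b - \<tau>))
        / Gamma (\<beta> + 1 + 1)) (at \<tau>)"
    unfolding taylor_kernel_def by (intro DERIV_cdivide DERIV_diff)
  then show ?thesis
    using assms unfolding G taylor_kernel_def
    by (simp add: right_diff_distrib[symmetric])
qed

text \<open>
  For \<open>\<tau> > t\<close> the point \<open>h = b - \<tau>\<close> lies inside the disc of convergence, so the error of the
  partial sum is the tail of the series. Its terms grow with \<open>h\<close> up to \<open>h = L\<close>, where they are
  \<open>L\<^sup>\<beta>\<close> times the coefficients, and the absolute tail of these is bounded by telescoping.
\<close>

lemma abs_taylor_kernel_le: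
  assumes "0 \<le> \<beta>" "\<beta> \<le> real (Suc N)" "t < \<tau>" "\<tau> \<le> b"
  shows "\<bar>taylor_kernel t b \<beta> N \<tau>\<bar>
           \<le> (b - t) powr \<beta> * \<bar>pochhammer (1 - \<beta>) N / fact N\<bar> / Gamma (\<beta> + 1)"
proof -
  define L where "L = b - t"
  define h where "h = b - \<tau>"
  define c where "c = (\<lambda>i. pochhammer (- \<beta>) i / fact i)"
  define u where "u = (\<lambda>i. c i * L powr (\<beta> - real i) * h ^ i)"
  have L: "L > 0" and h: "0 \<le> h" "h < L"
    using assms by (auto simp: L_def h_def)
  have "(\<lambda>i. (\<beta> gchoose i) * L powr (\<beta> - real i) * (- h) ^ i) sums (L + - h) powr \<beta>"
    using h by (intro gen_binomial_real'') auto
  also have "(\<lambda>i. (\<beta> gchoose i) * L powr (\<beta> - real i) * (- h) ^ i) = u"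
    by (simp add: u_def c_def gbinomial_pochhammer fun_eq_iff power_minus[of h])
  finally have "u sums (\<tau> - t) powr \<beta>"
    by (simp add: L_def h_def)
  then have tail: "(\<lambda>i. u (i + Suc N)) sums ((\<tau> - t) powr \<beta> - powr_taylor \<beta> L N h)"
    using sums_iff_shift[of u "Suc N"]
    by (simp add: powr_taylor_def u_def c_def lessThan_Suc_atMost)
  have u_le: "\<bar>u (i + Suc N)\<bar> \<le> L powr \<beta> * \<bar>c (i + Suc N)\<bar>" for i
  proof -
    have "L powr (\<beta> - real k) * h ^ k \<le> L powr (\<beta> - real k) * L ^ k" for k
      using h by (intro mult_left_mono power_mono) auto
    also have "L powr (\<beta> - real k) * L ^ k = L powr \<beta>" for k
      using L by (simp add: powr_diff powr_realpow)
    finally have "\<bar>c k\<bar> * (L powr (\<beta> - real k) * h ^ k) \<le> \<bar>c k\<bar> * L powr \<beta>" for k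
      by (intro mult_left_mono) auto
    from this[of "i + Suc N"] show ?thesis
      using h by (simp only: u_def abs_mult) (simp add: mult_ac)
  qed
  have "\<bar>\<Sum>i<j. u (i + Suc N)\<bar> \<le> L powr \<beta> * \<bar>pochhammer (1 - \<beta>) N / fact N\<bar>" for j
  proof -
    have "\<bar>\<Sum>i<j. u (i + Suc N)\<bar> \<le> (\<Sum>i<j. L powr \<beta> * \<bar>c (i + Suc N)\<bar>)"
      by (intro order_trans[OF sum_abs] sum_mono u_le)
    also have "\<dots> = L powr \<beta> * (\<Sum>i<j. \<bar>c (i + Suc N)\<bar>)"
      by (simp add: sum_distrib_left)
    also have "\<dots> \<le> L powr \<beta> * \<bar>pochhammer (1 - \<beta>) N / fact N\<bar>"
      unfolding c_def using assms by (intro mult_left_mono abs_binomial_coeff_tail) auto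
    finally show ?thesis .
  qed
  moreover have "(\<lambda>j. \<bar>\<Sum>i<j. u (i + Suc N)\<bar>) \<longlonglongrightarrow> \<bar>(\<tau> - t) powr \<beta> - powr_taylor \<beta> L N h\<bar>"
    using tail unfolding sums_def by (rule tendsto_rabs)
  ultimately have "\<bar>(\<tau> - t) powr \<beta> - powr_taylor \<beta> L N h\<bar>
                     \<le> L powr \<beta> * \<bar>pochhammer (1 - \<beta>) N / fact N\<bar>"
    by (intro LIMSEQ_le_const2) auto
  moreover have "Gamma (\<beta> + 1) > 0"
    using assms by (intro Gamma_real_pos) auto
  ultimately show ?thesis
    unfolding taylor_kernel_def L_def h_def abs_divide
    by (simp only: abs_of_pos divide_right_mono less_imp_le)
qed

section \<open>Repeated integration by parts\<close>

text \<open>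
  The integral of the lowered kernel is a conclusion, not a hypothesis: for \<open>\<beta> < 0\<close> that kernel is
  unbounded at \<open>t\<close>, and its integrability against \<open>G\<close> is obtained here from the bounded kernel
  with exponent \<open>\<beta> + 1 > 0\<close>, using derivatives on the open interval only.
\<close>

lemma taylor_kernel_integration_by_parts:
  fixes G G' :: "real \<Rightarrow> real"
  assumes "t < b" "\<beta> > - 1"
    and cont: "continuous_on {t..b} G"
    and deriv: "\<And>\<tau>. \<tau> \<in> {t<..<b} \<Longrightarrow> (G has_vector_derivative G' \<tau>) (at \<tau>)"
    and int: "((\<lambda>\<tau>. taylor_kernel t b (\<beta> + 1) (Suc m) \<tau> * G' \<tau>) has_integral I) {t..b}"
  shows "((\<lambda>\<tau>. taylor_kernel t b \<beta> m \<tau> * G \<tau>) has_integral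
           powr_taylor (\<beta> + 1) (b - t) (Suc m) (b - t) / Gamma (\<beta> + 2) * G t - I) {t..b}"
proof (rule integration_by_parts_interior[OF bounded_bilinear_mult])
  show "continuous_on {t..b} (taylor_kernel t b (\<beta> + 1) (Suc m))"
    using assms by (intro continuous_on_taylor_kernel) auto
  show "(taylor_kernel t b (\<beta> + 1) (Suc m) has_vector_derivative taylor_kernel t b \<beta> m \<tau>) (at \<tau>)"
    if "\<tau> \<in> {t<..<b}" for \<tau>
    using has_real_derivative_taylor_kernel[of \<beta> t \<tau> b m] that assms
    by (simp add: has_real_derivative_iff_has_vector_derivative)
  have "taylor_kernel t b (\<beta> + 1) (Suc m) t
          = - (powr_taylor (\<beta> + 1) (b - t) (Suc m) (b - t) / Gamma (\<beta> + 2))"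
    using assms by (simp add: taylor_kernel_def add.commute)
  then show "((\<lambda>\<tau>. taylor_kernel t b (\<beta> + 1) (Suc m) \<tau> * G' \<tau>) has_integral
      taylor_kernel t b (\<beta> + 1) (Suc m) b * G b - taylor_kernel t b (\<beta> + 1) (Suc m) t * G t
      - (powr_taylor (\<beta> + 1) (b - t) (Suc m) (b - t) / Gamma (\<beta> + 2) * G t - I)) {t..b}"
    using int \<open>t < b\<close> by (simp add: taylor_kernel_at_right_end)
qed (use assms in auto)

text \<open>
  Each step trades one derivative of \<open>g\<close> for one order of the kernel and changes the sign of the
  integral, until the exponent has come down from \<open>n - \<alpha>\<close> to the \<open>-\<alpha>\<close> of the Caputo integrand.
  No values of \<open>g\<close> at \<open>b\<close> appear, since every kernel with positive exponent vanishes there.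
\<close>

lemma taylor_kernel_iterated_parts:
  fixes g :: "nat \<Rightarrow> real \<Rightarrow> real"
  assumes "t < b" "0 < \<alpha>" "\<alpha> < 1"
    and cont: "\<And>p. p \<le> n \<Longrightarrow> continuous_on {t..b} (g p)"
    and deriv: "\<And>p \<tau>. p \<le> n \<Longrightarrow> \<tau> \<in> {t<..<b} \<Longrightarrow> (g p has_vector_derivative g (Suc p) \<tau>) (at \<tau>)"
    and int: "((\<lambda>\<tau>. taylor_kernel t b (real n - \<alpha>) (m + n) \<tau> * g (Suc n) \<tau>) has_integral I) {t..b}"
  shows "((\<lambda>\<tau>. taylor_kernel t b (- \<alpha>) m \<tau> * g 1 \<tau>) has_integral
           (- 1) ^ n * I - (\<Sum>p=1..n. (- 1) ^ p * (powr_taylor (real p - \<alpha>) (b - t) (m + p) (b - t)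
              / Gamma (real p + 1 - \<alpha>)) * g p t)) {t..b}"
  using cont deriv int
proof (induction n arbitrary: I)
  case 0
  then show ?case by simp
next
  case (Suc n)
  define J where "J = powr_taylor (real (Suc n) - \<alpha>) (b - t) (m + Suc n) (b - t)
              / Gamma (real (Suc n) + 1 - \<alpha>) * g (Suc n) t"
  have "((\<lambda>\<tau>. taylor_kernel t b (real n - \<alpha>) (m + n) \<tau> * g (Suc n) \<tau>) has_integral J - I) {t..b}"
    using taylor_kernel_integration_by_parts[of t b "real n - \<alpha>" "g (Suc n)" "g (Suc (Suc n))" "m + n" I]
      Suc.prems assms(1-3)
    by (simp add: J_def algebra_simps)
  from Suc.IH[OF _ _ this] Suc.prems show ?case
    by (simp add: J_def algebra_simps)
qed

section \<open>The coefficients of the expansion\<close>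

text \<open>
  The substitution \<open>i = l + p - n\<close> turns the sum into one over \<open>1 \<le> i \<le> N - n + p\<close>, with the
  leading 1 as the missing term \<open>i = 0\<close>. The quotient of Gamma values is a rising factorial
  because \<open>\<alpha> - p\<close> is not an integer.
\<close>

lemma coeff_C_eq_powr_taylor:
  assumes "0 < \<alpha>" "\<alpha> < 1" "p \<le> n" "n \<le> N" "L > 0"
  shows "coeff_C n N \<alpha> p * L powr (real p - \<alpha>)
           = (- 1) ^ p * (powr_taylor (real p - \<alpha>) L (N - n + p) L / Gamma (real p + 1 - \<alpha>))"
proof -
  have nonpole: "\<alpha> - real p \<notin> \<int>\<^sub>\<le>\<^sub>0"
  proof
    assume "\<alpha> - real p \<in> \<int>\<^sub>\<le>\<^sub>0"
    then obtain z :: int where "\<alpha> - real p = of_int z"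
      by (auto elim!: nonpos_Ints_cases)
    then have "\<alpha> = of_int (z + int p)"
      by simp
    with assms have "0 < z + int p" "z + int p < 1"
      by auto
    then show False by simp
  qed
  have "(\<Sum>l = n - p + 1..N. Gamma (\<alpha> - real n + real l) / (Gamma (\<alpha> - real p) * fact (l + p - n)))
      = (\<Sum>i = 1..N - n + p. pochhammer (\<alpha> - real p) i / fact i)"
    using assms pochhammer_Gamma[OF nonpole]
    by (intro sum.reindex_bij_witness[of _ "\<lambda>i. i + n - p" "\<lambda>l. l + p - n"])
       (auto simp: of_nat_diff algebra_simps)
  then have "1 + (\<Sum>l = n - p + 1..N. Gamma (\<alpha> - real n + real l) / (Gamma (\<alpha> - real p) * fact (l + p - n)))
      = (\<Sum>i\<le>N - n + p. pochhammer (- (real p - \<alpha>)) i / fact i)"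
    by (simp add: atMost_atLeast0 sum.atLeast_Suc_atMost)
  then show ?thesis
    using assms by (simp add: coeff_C_def powr_taylor_full)
qed

lemma sum_coeff_D_eq_powr_taylor:
  assumes "0 < \<alpha>" "n \<le> N"
  shows "(\<Sum>p = n..N. coeff_D n \<alpha> p * L powr (real n - real p - \<alpha>) * h ^ (p - n))
           = - (powr_taylor (- \<alpha>) L (N - n) h / Gamma (1 - \<alpha>))"
proof -
  have nonpole: "\<alpha> \<notin> \<int>\<^sub>\<le>\<^sub>0"
    using assms by (auto elim!: nonpos_Ints_cases)
  have "(\<Sum>p = n..N. coeff_D n \<alpha> p * L powr (real n - real p - \<alpha>) * h ^ (p - n))
      = (\<Sum>i\<le>N - n. - (pochhammer \<alpha> i / fact i * L powr (- \<alpha> - real i) * h ^ i / Gamma (1 - \<alpha>)))"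
    using assms pochhammer_Gamma[OF nonpole]
    by (intro sum.reindex_bij_witness[of _ "\<lambda>i. i + n" "\<lambda>p. p - n"])
       (auto simp: coeff_D_def of_nat_diff algebra_simps)
  then show ?thesis
    by (simp add: powr_taylor_def sum_negf sum_divide_distrib)
qed

section \<open>The expansion in one variable\<close>

text \<open>
  The identity is obtained by solving the iterated integration by parts for the singular part of
  the last kernel. This also settles the existence of the Caputo integral, as the sum of two
  integrals that exist.
\<close>

lemma caputo_expansion_one_variable:
  fixes g :: "nat \<Rightarrow> real \<Rightarrow> real"
  assumes "t < b" "0 < \<alpha>" "\<alpha> < 1" "1 \<le> n" "n \<le> N"
    and cont: "\<And>p. p \<le> Suc n \<Longrightarrow> continuous_on {t..b} (g p)"
    and deriv: "\<And>p \<tau>. p \<le> n \<Longrightarrow> \<tau> \<in> {t<..<b} \<Longrightarrow> (g p has_vector_derivative g (Suc p) \<tau>) (at \<tau>)"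
    and M: "\<And>\<tau>. \<tau> \<in> {t..b} \<Longrightarrow> \<bar>g (Suc n) \<tau>\<bar> \<le> M"
  shows "\<exists>E. - 1 / Gamma (1 - \<alpha>) * integral {t..b} (\<lambda>\<tau>. (\<tau> - t) powr (- \<alpha>) * g 1 \<tau>)
           = (\<Sum>p = 1..n. coeff_C n N \<alpha> p * (b - t) powr (real p - \<alpha>) * g p t)
             + (\<Sum>p = n..N. coeff_D n \<alpha> p * (b - t) powr (real n - real p - \<alpha>)
                   * integral {t..b} (\<lambda>\<tau>. (b - \<tau>) ^ (p - n) * g 1 \<tau>))
             + E
           \<and> \<bar>E\<bar> \<le> M * (exp ((real n - \<alpha>)\<^sup>2 + real n - \<alpha>)
                  / (Gamma (real n + 1 - \<alpha>) * real N powr (real n - \<alpha>) * (real n - \<alpha>)))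
                 * (b - t) powr (real n + 1 - \<alpha>)"
proof -
  define L where "L = b - t"
  define \<gamma> where "\<gamma> = real n - \<alpha>"
  define m where "m = N - n"
  define S where "S = (\<Sum>p=1..n. (- 1) ^ p * (powr_taylor (real p - \<alpha>) L (m + p) L
              / Gamma (real p + 1 - \<alpha>)) * g p t)"
  have L: "L > 0" and \<gamma>: "\<gamma> > 0" "real n - 1 \<le> \<gamma>" "\<gamma> \<le> real n" and N: "N = m + n"
    using assms by (auto simp: L_def \<gamma>_def m_def)
  have G1: "Gamma (1 - \<alpha>) > 0" and G\<gamma>: "Gamma (\<gamma> + 1) > 0"
    using assms \<gamma> by (auto intro!: Gamma_real_pos)
  have M0: "M \<ge> 0"
    using M[of t] \<open>t < b\<close> by auto
  define I where "I = integral {t..b} (\<lambda>\<tau>. taylor_kernel t b \<gamma> N \<tau> * g (Suc n) \<tau>)"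
  have I: "((\<lambda>\<tau>. taylor_kernel t b \<gamma> N \<tau> * g (Suc n) \<tau>) has_integral I) {t..b}"
    unfolding I_def using \<gamma> cont
    by (intro integrable_integral integrable_continuous_interval continuous_intros
        continuous_on_taylor_kernel) auto

  have kernel: "((\<lambda>\<tau>. taylor_kernel t b (- \<alpha>) m \<tau> * g 1 \<tau>) has_integral (- 1) ^ n * I - S) {t..b}"
    unfolding S_def L_def
    using assms I by (intro taylor_kernel_iterated_parts) (auto simp: \<gamma>_def N)
  \<comment> \<open>The polynomial part, removed from the Caputo integrand by the last kernel.\<close>
  define Q where "Q = (\<lambda>\<tau>. powr_taylor (- \<alpha>) L m (b - \<tau>) / Gamma (1 - \<alpha>) * g 1 \<tau>)"
  have contg1: "continuous_on {t..b} (g 1)"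
    using cont[of 1] assms by simp
  have Q: "(Q has_integral integral {t..b} Q) {t..b}"
    unfolding Q_def using G1 contg1
    by (intro integrable_integral integrable_continuous_interval continuous_intros) auto
  have "((\<lambda>\<tau>. Gamma (1 - \<alpha>) * (taylor_kernel t b (- \<alpha>) m \<tau> * g 1 \<tau> + Q \<tau>)) has_integral
          Gamma (1 - \<alpha>) * ((- 1) ^ n * I - S + integral {t..b} Q)) {t..b}"
    by (intro has_integral_mult_right has_integral_add kernel Q)
  also have "(\<lambda>\<tau>. Gamma (1 - \<alpha>) * (taylor_kernel t b (- \<alpha>) m \<tau> * g 1 \<tau> + Q \<tau>))
              = (\<lambda>\<tau>. (\<tau> - t) powr (- \<alpha>) * g 1 \<tau>)"
    using G1 by (auto simp: Q_def taylor_kernel_def L_def fun_eq_iff field_simps)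
  finally have "integral {t..b} (\<lambda>\<tau>. (\<tau> - t) powr (- \<alpha>) * g 1 \<tau>)
                  = Gamma (1 - \<alpha>) * ((- 1) ^ n * I - S + integral {t..b} Q)"
    by (rule integral_unique)
  then have main: "- 1 / Gamma (1 - \<alpha>) * integral {t..b} (\<lambda>\<tau>. (\<tau> - t) powr (- \<alpha>) * g 1 \<tau>)
                  = S - integral {t..b} Q + (- 1) ^ Suc n * I"
    using G1 by simp

  have SC: "S = (\<Sum>p = 1..n. coeff_C n N \<alpha> p * L powr (real p - \<alpha>) * g p t)"
    unfolding S_def m_def using assms L by (intro sum.cong) (auto simp: coeff_C_eq_powr_taylor)
  have "((\<lambda>\<tau>. \<Sum>p = n..N. coeff_D n \<alpha> p * L powr (real n - real p - \<alpha>) * ((b - \<tau>) ^ (p - n) * g 1 \<tau>))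
          has_integral (\<Sum>p = n..N. coeff_D n \<alpha> p * L powr (real n - real p - \<alpha>)
                   * integral {t..b} (\<lambda>\<tau>. (b - \<tau>) ^ (p - n) * g 1 \<tau>))) {t..b}"
    using contg1
    by (intro has_integral_sum has_integral_mult_right integrable_integral
        integrable_continuous_interval continuous_intros) auto
  moreover have "(\<lambda>\<tau>. \<Sum>p = n..N. coeff_D n \<alpha> p * L powr (real n - real p - \<alpha>) * ((b - \<tau>) ^ (p - n) * g 1 \<tau>))
      = (\<lambda>\<tau>. - Q \<tau>)"
    using sum_coeff_D_eq_powr_taylor[of \<alpha> n N L] assms
    by (simp add: fun_eq_iff Q_def m_def mult.assoc[symmetric] sum_distrib_right[symmetric])
  ultimately have QD: "- integral {t..b} Q = (\<Sum>p = n..N. coeff_D n \<alpha> p * L powr (real n - real p - \<alpha>)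
                   * integral {t..b} (\<lambda>\<tau>. (b - \<tau>) ^ (p - n) * g 1 \<tau>))"
    using has_integral_neg[OF Q] by (metis (no_types, lifting) has_integral_unique)

  define s where "s = \<bar>pochhammer (1 - \<gamma>) N / fact N\<bar>"
  \<comment> \<open>The kernel bound is available for \<open>\<tau> > t\<close> only, so the left end point is left out.\<close>
  have "norm I \<le> L powr \<gamma> * s / Gamma (\<gamma> + 1) * M * Henstock_Kurzweil_Integration.content (cbox t b)"
  proof (rule has_integral_bound_spike_finite)
    show "0 \<le> L powr \<gamma> * s / Gamma (\<gamma> + 1) * M"
      using M0 G\<gamma> by (simp add: s_def)
    show "finite {t}" by simp
    show "((\<lambda>\<tau>. taylor_kernel t b \<gamma> N \<tau> * g (Suc n) \<tau>) has_integral I) (cbox t b)"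
      using I by simp
    fix \<tau> assume "\<tau> \<in> cbox t b - {t}"
    then show "norm (taylor_kernel t b \<gamma> N \<tau> * g (Suc n) \<tau>) \<le> L powr \<gamma> * s / Gamma (\<gamma> + 1) * M"
      unfolding real_norm_def abs_mult s_def L_def using \<gamma> G\<gamma> assms
      by (intro mult_mono abs_taylor_kernel_le M) auto
  qed
  also have "\<dots> = s * (M * L powr (\<gamma> + 1) / Gamma (\<gamma> + 1))"
    using \<open>t < b\<close> L by (simp add: L_def powr_add)
  also have "\<dots> \<le> exp (\<gamma>\<^sup>2 + \<gamma>) / (real N powr \<gamma> * \<gamma>) * (M * L powr (\<gamma> + 1) / Gamma (\<gamma> + 1))"
  proof (rule mult_right_mono)
    have "s * real N powr \<gamma> \<le> s * real (Suc N) powr \<gamma>"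
      using \<gamma> by (intro mult_left_mono powr_mono2) (auto simp: s_def)
    also have "\<dots> \<le> exp (\<gamma>\<^sup>2)"
      using abs_binomial_coeff_decay[OF \<gamma>(2,3) \<open>1 \<le> n\<close>, of "Suc m"] \<open>1 \<le> n\<close>
      by (simp add: s_def N add.commute)
    finally have "s * real N powr \<gamma> \<le> exp (\<gamma>\<^sup>2)" .
    moreover have "\<gamma> \<le> exp \<gamma>"
      using exp_ge_add_one_self[of \<gamma>] by linarith
    ultimately have "s * real N powr \<gamma> * \<gamma> \<le> exp (\<gamma>\<^sup>2) * exp \<gamma>"
      using \<gamma> by (intro mult_mono) auto
    then show "s \<le> exp (\<gamma>\<^sup>2 + \<gamma>) / (real N powr \<gamma> * \<gamma>)"
      using \<gamma> assms by (simp add: exp_add field_simps)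
    show "0 \<le> M * L powr (\<gamma> + 1) / Gamma (\<gamma> + 1)"
      using M0 G\<gamma> by simp
  qed
  also have "\<dots> = M * (exp (\<gamma>\<^sup>2 + \<gamma>) / (Gamma (\<gamma> + 1) * real N powr \<gamma> * \<gamma>)) * L powr (\<gamma> + 1)"
    by (simp add: ac_simps)
  finally have "\<bar>(- 1) ^ Suc n * I\<bar>
      \<le> M * (exp (\<gamma>\<^sup>2 + \<gamma>) / (Gamma (\<gamma> + 1) * real N powr \<gamma> * \<gamma>)) * L powr (\<gamma> + 1)"
    by (simp add: abs_mult power_abs)
  moreover have "\<gamma> + 1 = real n + 1 - \<alpha>" "\<gamma>\<^sup>2 + \<gamma> = (real n - \<alpha>)\<^sup>2 + real n - \<alpha>"
    by (simp_all add: \<gamma>_def)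
  ultimately have "\<bar>(- 1) ^ Suc n * I\<bar> \<le> M * (exp ((real n - \<alpha>)\<^sup>2 + real n - \<alpha>)
                  / (Gamma (real n + 1 - \<alpha>) * real N powr (real n - \<alpha>) * (real n - \<alpha>)))
                 * (b - t) powr (real n + 1 - \<alpha>)"
    by (simp only: \<gamma>_def L_def)
  moreover have "- 1 / Gamma (1 - \<alpha>) * integral {t..b} (\<lambda>\<tau>. (\<tau> - t) powr (- \<alpha>) * g 1 \<tau>)
           = (\<Sum>p = 1..n. coeff_C n N \<alpha> p * (b - t) powr (real p - \<alpha>) * g p t)
             + (\<Sum>p = n..N. coeff_D n \<alpha> p * (b - t) powr (real n - real p - \<alpha>)
                   * integral {t..b} (\<lambda>\<tau>. (b - \<tau>) ^ (p - n) * g 1 \<tau>))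
             + (- 1) ^ Suc n * I"
    using main SC QD by (simp add: L_def)
  ultimately show ?thesis by blast
qed

section \<open>Functions on the box along a coordinate line\<close>

lemma subst_coord_subst_coord [simp]: "subst_coord (subst_coord t k \<sigma>) k \<tau> = subst_coord t k \<tau>"
  by (simp add: subst_coord_def vec_eq_iff)

lemma subst_coord_nth_same [simp]: "subst_coord t k \<tau> $ k = \<tau>"
  by (simp add: subst_coord_def)

lemma subst_coord_in_cbox:
  "t \<in> cbox a b \<Longrightarrow> \<tau> \<in> {a $ k..b $ k} \<Longrightarrow> subst_coord t k \<tau> \<in> cbox a b"
  by (simp add: subst_coord_def mem_box_cart)

lemma continuous_on_subst_coord: "continuous_on S (subst_coord t k)"
  unfolding subst_coord_def
proof (rule continuous_on_vec_lambda)
  show "continuous_on S (\<lambda>\<tau>. if i = k then \<tau> else t $ i)" for i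
    by (cases "i = k") (auto intro: continuous_intros)
qed

lemma Cr_on_box_imp_continuous_on: "Cr_on_box r a b f \<Longrightarrow> continuous_on (cbox a b) f"
  by (cases r) auto

text \<open>
  The surplus smoothness \<open>r\<close> has to vary in the induction, since every partial derivative uses up
  one order.
\<close>

lemma Cr_on_box_higher_partial_deriv:
  "Cr_on_box (p + r) a b f \<Longrightarrow> Cr_on_box r a b (higher_partial_deriv p a b k f)"
proof (induction p arbitrary: r)
  case (Suc p)
  then show ?case
    using Suc.IH[of "Suc r"] by simp
qed simp

lemma continuous_on_higher_partial_deriv_line:
  assumes "Cr_on_box r a b f" "p \<le> r" "t \<in> cbox a b"
  shows "continuous_on {a $ k..b $ k} (\<lambda>\<tau>. higher_partial_deriv p a b k f (subst_coord t k \<tau>))"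
proof -
  have "Cr_on_box (r - p) a b (higher_partial_deriv p a b k f)"
    using assms by (intro Cr_on_box_higher_partial_deriv) simp
  then have "continuous_on (cbox a b) (higher_partial_deriv p a b k f)"
    by (rule Cr_on_box_imp_continuous_on)
  then show ?thesis
    using subst_coord_in_cbox[OF assms(3)]
    by (intro continuous_on_compose2[OF _ continuous_on_subst_coord]) auto
qed

text \<open>
  Partial derivatives are taken within \<open>[a\<^sub>k, b\<^sub>k]\<close>. At interior points of this interval they are
  ordinary derivatives along the line, which is all that integration by parts asks for.
\<close>

lemma has_vector_derivative_higher_partial_deriv_line:
  assumes "Cr_on_box r a b f" "p < r" "t \<in> cbox a b" "\<tau> \<in> {a $ k<..<b $ k}"
  shows "((\<lambda>\<tau>. higher_partial_deriv p a b k f (subst_coord t k \<tau>)) has_vector_derivative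
            higher_partial_deriv (Suc p) a b k f (subst_coord t k \<tau>)) (at \<tau>)"
proof -
  have "Cr_on_box (Suc (r - Suc p)) a b (higher_partial_deriv p a b k f)"
    using assms by (intro Cr_on_box_higher_partial_deriv) simp
  then have "partial_differentiable a b k (higher_partial_deriv p a b k f) (subst_coord t k \<tau>)"
    using subst_coord_in_cbox[OF assms(3), of \<tau> k] assms(4) by simp
  then have "((\<lambda>\<tau>. higher_partial_deriv p a b k f (subst_coord t k \<tau>)) has_vector_derivative
            higher_partial_deriv (Suc p) a b k f (subst_coord t k \<tau>)) (at \<tau> within {a $ k..b $ k})"
    by (simp add: partial_differentiable_def partial_deriv_def vector_derivative_works)
  moreover have "at \<tau> within {a $ k..b $ k} = at \<tau>"
    using assms(4) by (intro at_within_interior) simp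
  ultimately show ?thesis by simp
qed

text \<open>
  \<^const>\<open>max_M\<close> is defined by \<^const>\<open>Greatest\<close>, which says something only if a greatest value
  exists. It does because the derivative is continuous on a compact interval.
\<close>

lemma higher_partial_deriv_le_max_M:
  assumes "Cr_on_box r a b f" "p \<le> r" "t \<in> cbox a b" "\<tau> \<in> {t $ k..b $ k}"
  shows "\<bar>higher_partial_deriv p a b k f (subst_coord t k \<tau>)\<bar> \<le> max_M a b k f p t"
proof -
  define V where "V = (\<lambda>\<tau>. \<bar>higher_partial_deriv p a b k f (subst_coord t k \<tau>)\<bar>) ` {t $ k..b $ k}"
  have "a $ k \<le> t $ k"
    using assms(3) by (simp add: mem_box_cart)
  then have "continuous_on {t $ k..b $ k} (\<lambda>\<tau>. \<bar>higher_partial_deriv p a b k f (subst_coord t k \<tau>)\<bar>)"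
    using continuous_on_higher_partial_deriv_line[OF assms(1-3), of k]
    by (intro continuous_on_rabs) (auto elim!: continuous_on_subset)
  then have "compact V" "V \<noteq> {}"
    unfolding V_def using assms(4) by (auto intro!: compact_continuous_image)
  then obtain v where v: "v \<in> V" "\<And>w. w \<in> V \<Longrightarrow> w \<le> v"
    using compact_attains_sup by metis
  then have "max_M a b k f p t = v"
    unfolding max_M_def V_def by (intro Greatest_equality) auto
  moreover have "\<bar>higher_partial_deriv p a b k f (subst_coord t k \<tau>)\<bar> \<in> V"
    using assms(4) by (auto simp: V_def)
  ultimately show ?thesis
    using v by simp
qed

section \<open>The expansion on the box\<close>

theorem theorem15:
  fixes a b :: "real ^ 'm::finite"
    and x :: "real ^ 'm \<Rightarrow> real"
    and \<alpha> :: "'m \<Rightarrow> real \<Rightarrow> real"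
    and n :: nat
  assumes "n \<ge> 1"
    and "Cr_on_box (n + 1) a b x"
    and "\<forall>k. \<forall>s\<in>{a $ k..b $ k}. \<alpha> k s \<in> {0<..<1}"
  shows "\<forall>(k::'m) (N::nat) t. N \<ge> n \<longrightarrow> t \<in> cbox a b \<longrightarrow> t $ k < b $ k \<longrightarrow>
    (let \<alpha>' = \<alpha> k (t $ k); L = b $ k - t $ k in
     \<exists>E::real.
       caputo_right_III a b k (\<alpha> k) x t =
         (\<Sum>p = 1..n. coeff_C n N \<alpha>' p * L powr (real p - \<alpha>')
                       * higher_partial_deriv p a b k x (subst_coord t k (t $ k)))
         + (\<Sum>p = n..N. coeff_D n \<alpha>' p * L powr (real n - real p - \<alpha>') * moment_W a b k n x p t)
         + E
       \<and> E \<le> max_M a b k x (n + 1) t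
               * (exp ((real n - \<alpha>')\<^sup>2 + real n - \<alpha>')
                  / (Gamma (real n + 1 - \<alpha>') * real N powr (real n - \<alpha>') * (real n - \<alpha>')))
               * L powr (real n + 1 - \<alpha>'))"
proof (intro allI impI)
  fix k :: 'm and N :: nat and t :: "real ^ 'm"
  assume N: "N \<ge> n" and t: "t \<in> cbox a b" and tb: "t $ k < b $ k"
  \<comment> \<open>The derivatives along the coordinate line through \<open>t\<close>; \<open>g 0\<close> is \<open>x\<close> itself.\<close>
  define g where "g = (\<lambda>p \<tau>. higher_partial_deriv p a b k x (subst_coord t k \<tau>))"
  have at: "a $ k \<le> t $ k"
    using t by (simp add: mem_box_cart)
  have \<alpha>: "0 < \<alpha> k (t $ k)" "\<alpha> k (t $ k) < 1"
    using assms(3) at tb by auto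
  have cont: "continuous_on {t $ k..b $ k} (g p)" if "p \<le> Suc n" for p
    unfolding g_def
    by (rule continuous_on_subset[OF continuous_on_higher_partial_deriv_line[OF assms(2)]])
       (use that t at in auto)
  have deriv: "(g p has_vector_derivative g (Suc p) \<tau>) (at \<tau>)"
    if "p \<le> n" "\<tau> \<in> {t $ k<..<b $ k}" for p \<tau>
    unfolding g_def
    by (rule has_vector_derivative_higher_partial_deriv_line[OF assms(2)]) (use that t at in auto)
  have M: "\<bar>g (Suc n) \<tau>\<bar> \<le> max_M a b k x (n + 1) t" if "\<tau> \<in> {t $ k..b $ k}" for \<tau>
    using higher_partial_deriv_le_max_M[OF assms(2) _ t that, of "n + 1"] by (simp add: g_def)
  have g1: "partial_deriv a b k x (subst_coord t k \<tau>) = g 1 \<tau>" for \<tau>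
    by (simp add: g_def)
  obtain E where
    "- 1 / Gamma (1 - \<alpha> k (t $ k)) * integral {t $ k..b $ k} (\<lambda>\<tau>. (\<tau> - t $ k) powr (- \<alpha> k (t $ k)) * g 1 \<tau>)
           = (\<Sum>p = 1..n. coeff_C n N (\<alpha> k (t $ k)) p * (b $ k - t $ k) powr (real p - \<alpha> k (t $ k)) * g p (t $ k))
             + (\<Sum>p = n..N. coeff_D n (\<alpha> k (t $ k)) p * (b $ k - t $ k) powr (real n - real p - \<alpha> k (t $ k))
                   * integral {t $ k..b $ k} (\<lambda>\<tau>. (b $ k - \<tau>) ^ (p - n) * g 1 \<tau>))
             + E"
    and "\<bar>E\<bar> \<le> max_M a b k x (n + 1) t * (exp ((real n - \<alpha> k (t $ k))\<^sup>2 + real n - \<alpha> k (t $ k))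
                  / (Gamma (real n + 1 - \<alpha> k (t $ k)) * real N powr (real n - \<alpha> k (t $ k)) * (real n - \<alpha> k (t $ k))))
                 * (b $ k - t $ k) powr (real n + 1 - \<alpha> k (t $ k))"
    using caputo_expansion_one_variable[where g = g, OF tb \<alpha> assms(1) N cont deriv M] by blast
  then show "let \<alpha>' = \<alpha> k (t $ k); L = b $ k - t $ k in
     \<exists>E::real.
       caputo_right_III a b k (\<alpha> k) x t =
         (\<Sum>p = 1..n. coeff_C n N \<alpha>' p * L powr (real p - \<alpha>')
                       * higher_partial_deriv p a b k x (subst_coord t k (t $ k)))
         + (\<Sum>p = n..N. coeff_D n \<alpha>' p * L powr (real n - real p - \<alpha>') * moment_W a b k n x p t)
         + E
       \<and> E \<le> max_M a b k x (n + 1) t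
               * (exp ((real n - \<alpha>')\<^sup>2 + real n - \<alpha>')
                  / (Gamma (real n + 1 - \<alpha>') * real N powr (real n - \<alpha>') * (real n - \<alpha>')))
               * L powr (real n + 1 - \<alpha>')"
    unfolding Let_def caputo_right_III_def moment_W_def g1
    by (intro exI[of _ E] conjI) (auto simp only: g_def abs_le_iff)
qed

end
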